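(* Let $f=(f_n)$ be a sequence of paired functions, with a sharp threshold at $p_c\in(0,1)$. Then $K_2(f)\le\omega(\log n)$; that is, every function $k(n)$ with $k(n)/\log n\to\infty$ (and $k(n)\le n$) belongs to $K_2(f)$.
   Context: $\mathcal{A}(n,k,p)$ is the set of all probability distributions $\mathbb{Q}$ of $n$ bits $(X_1,\ldots,X_n)\in\{0,1\}^n$ that are $k$-wise independent (every subset of at most $k$ of the bits is independent) and satisfy $\mathbb{Q}(X_i=1)=p$ for all $i$. For $f:\{0,1\}^n\to\{0,1\}$, $\varepsilon^f(k,p)=\max_{\mathbb{Q}\in\mathcal{A}(n,k,p)}\mathbb{Q}(f=1)-\min_{\mathbb{Q}\in\mathcal{A}(n,k,p)}\mathbb{Q}(f=1)$. A sequence $(f_n)$ of monotone boolean functions has a sharp threshold at $p_c$ if, under fully independent bits with marginal $p$, the probability of $f_n=1$ tends to $0$ for $p<p_c$ and to $1$ for $p>p_c$. $K_2(f)$ is the class of (integer-valued) functions $k(n)$ such that $\varepsilon^{f_n}(k(n),p_c)\to0$ as $n\to\infty$. Paired functions: let $n=2^{2m}$ and let the $n$ input bits be divided into disjoint sets $A_i$ consisting of $m$ bits each (up to fewer than $m$ leftover bits if $m$ does not divide $n$). A function on $n$ bits is paired if it is the OR of AND gates, each of which is the AND of all the bits in the union of exactly two of the sets $A_i$. The sequence is indexed by $n$ of the form $2^{2m}$. *)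

theory Defs
  imports "HOL-Probability.Probability"
begin

text \<open>
  The cube \<open>{0,1}\<^sup>n\<close>: bit vectors are functions on the naturals that vanish outside
  \<open>{..<n}\<close>. This is the support convention of \<open>Pi_pmf {..<n} False\<close>. Boolean functions on
  \<open>n\<close> bits are functions \<open>(nat \<Rightarrow> bool) \<Rightarrow> bool\<close>, of which only the values on the cube matter.
\<close>

definition cube :: "nat \<Rightarrow> (nat \<Rightarrow> bool) set" where
  "cube n = {x. \<forall>i\<ge>n. \<not> x i}"

definition kwise_indep :: "nat \<Rightarrow> nat \<Rightarrow> real \<Rightarrow> (nat \<Rightarrow> bool) pmf set" where
  "kwise_indep n k p = {Q. set_pmf Q \<subseteq> cube n \<and>
     (\<forall>I \<subseteq> {..<n}. card I \<le> k \<longrightarrow>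
        prob_space.indep_vars (measure_pmf Q) (\<lambda>_. count_space UNIV) (\<lambda>i x. x i) I) \<and>
     (\<forall>i<n. measure_pmf.prob Q {x. x i} = p)}"

text \<open>
  \<open>kwise_indep n k p\<close> is a compact subset of the simplex of distributions on the cube, nonempty
  for \<open>0 \<le> p \<le> 1\<close>, so supremum and infimum are the maximum and the minimum.
\<close>

definition indep_gap :: "nat \<Rightarrow> ((nat \<Rightarrow> bool) \<Rightarrow> bool) \<Rightarrow> nat \<Rightarrow> real \<Rightarrow> real" where
  "indep_gap n f k p =
     (SUP Q \<in> kwise_indep n k p. measure_pmf.prob Q {x. f x}) -
     (INF Q \<in> kwise_indep n k p. measure_pmf.prob Q {x. f x})"

definition iid_bits :: "nat \<Rightarrow> real \<Rightarrow> (nat \<Rightarrow> bool) pmf" where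
  "iid_bits n p = Pi_pmf {..<n} False (\<lambda>_. bernoulli_pmf p)"

text \<open>
  Sequences \<open>(f\<^sub>n)\<close> are indexed by the \<open>n\<close> in an infinite set \<open>S\<close>; limits are taken as
  \<open>n \<longrightarrow> \<infinity>\<close> within \<open>S\<close>.
\<close>

abbreviation along :: "nat set \<Rightarrow> nat filter" where
  "along S \<equiv> inf sequentially (principal S)"

definition sharp_threshold ::
    "nat set \<Rightarrow> (nat \<Rightarrow> (nat \<Rightarrow> bool) \<Rightarrow> bool) \<Rightarrow> real \<Rightarrow> bool" where
  "sharp_threshold S f pc \<longleftrightarrow>
     (\<forall>n\<in>S. mono_on (cube n) (f n)) \<and>
     (\<forall>p. 0 \<le> p \<and> p \<le> 1 \<and> p < pc \<longrightarrow>
        ((\<lambda>n. measure_pmf.prob (iid_bits n p) {x. f n x}) \<longlongrightarrow> 0) (along S)) \<and>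
     (\<forall>p. 0 \<le> p \<and> p \<le> 1 \<and> pc < p \<longrightarrow>
        ((\<lambda>n. measure_pmf.prob (iid_bits n p) {x. f n x}) \<longlongrightarrow> 1) (along S))"

definition K2 :: "nat set \<Rightarrow> (nat \<Rightarrow> (nat \<Rightarrow> bool) \<Rightarrow> bool) \<Rightarrow> real \<Rightarrow> (nat \<Rightarrow> nat) set" where
  "K2 S f pc = {k. ((\<lambda>n. indep_gap n (f n) (k n) pc) \<longlongrightarrow> 0) (along S)}"

definition paired_sizes :: "nat set" where
  "paired_sizes = {2 ^ (2 * m) |m. m \<ge> 1}"

text \<open>
  \<open>\<A>\<close> is the family of the disjoint blocks of \<open>m\<close> bits, and each element of \<open>G\<close> is the pair
  of blocks that one AND gate reads.
\<close>

definition paired :: "nat \<Rightarrow> ((nat \<Rightarrow> bool) \<Rightarrow> bool) \<Rightarrow> bool" where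
  "paired n f \<longleftrightarrow> (\<exists>m \<A> G. m \<ge> 1 \<and> n = 2 ^ (2 * m) \<and>
     disjoint \<A> \<and> (\<forall>B\<in>\<A>. B \<subseteq> {..<n} \<and> card B = m) \<and> card ({..<n} - \<Union>\<A>) < m \<and>
     G \<subseteq> {(B, C). B \<in> \<A> \<and> C \<in> \<A> \<and> B \<noteq> C} \<and>
     (\<forall>x\<in>cube n. f x \<longleftrightarrow> (\<exists>(B, C)\<in>G. \<forall>i\<in>B \<union> C. x i)))"

end

theory Submission imports Defs begin

text \<open>
  Let \<open>S\<close> be the random set of blocks all of whose bits are 1. With \<open>q = p ^ m\<close>, a set \<open>V\<close> of at most
  \<open>c = k / m\<close> blocks lies in \<open>S\<close> with probability \<open>q ^ |V|\<close>, and \<open>c\<close> tends to infinity. The function is 1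
  iff \<open>S\<close> contains an edge of the graph \<open>G\<close> of the pairs that are read. The claim is that a bounded
  order \<open>c\<close> determines the probability of this event up to \<open>\<eta>\<close>, whatever \<open>G\<close> and \<open>q\<close> are.

  Fix a large \<open>t\<close>, put \<open>D = \<lceil>t\<^sup>2 / q\<rceil>\<close>, and let \<open>E\<close> be a maximal subgraph of \<open>G\<close> with degrees at most \<open>D\<close>.
  If \<open>|E| q\<^sup>2 \<ge> t\<^sup>3\<close>, then by Chebyshev \<open>S\<close> contains an edge of \<open>E\<close> with high probability. Otherwise there are
  at most \<open>2 t / q\<close> vertices of degree \<open>D\<close> in \<open>E\<close>; by maximality every edge outside \<open>E\<close> meets one of them,
  and, again by Chebyshev, if one of them is in \<open>S\<close>, then most likely so is one of its neighbours.
  Hence the event is approximately \<open>W \<noteq> 0\<close>, where \<open>W\<close> counts the edges of \<open>E\<close> and the vertices of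
  degree \<open>D\<close> that are contained in \<open>S\<close>.

  The moments of \<open>W\<close> of order up to \<open>c / 2\<close> are determined by \<open>q\<close>, but they grow too fast for Bonferroni's
  inequalities. Instead, \<open>W = 0\<close> is detected by \<open>sin (t \<surd>W) / (t \<surd>W)\<close>, which is 1 at 0 and at most
  \<open>1 / t\<close> at the positive integers. The remainder of its Taylor polynomial in \<open>W\<close> is
  \<open>(t\<^sup>2 W) ^ r / (2 r + 1)!\<close>, and \<open>E (W ^ r) \<le> C ^ r \<Sum>i\<le>2r. i ^ (2r - i)\<close>, which is small enough because
  \<open>z ^ n / n! * (\<Sum>i\<le>n. i ^ (n - i))\<close> is at most the \<open>n\<close>-th term of the series of \<open>exp (z exp z)\<close>.
\<close>

subsection \<open>Analytic estimates\<close>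

text \<open>As \<open>fact i * fact (n - i)\<close> is at most \<open>fact n\<close>, the sequence
  is dominated by \<open>b\<close>, the antidiagonal sums of the double series with terms z^i / i! *
  (i z)^j / j!. Summing over j first gives the total exp(z exp z), so \<open>b\<close> is
  summable.\<close>

lemma sum_power_over_fact_tendsto_0:
  fixes z :: real
  assumes "0 \<le> z"
  shows "(\<lambda>n. z ^ n * (\<Sum>i\<le>n. real i ^ (n - i)) / fact n) \<longlonglongrightarrow> 0"
proof -
  define b where "b n = (\<Sum>i\<le>n. (z ^ i / fact i) * ((real i * z) ^ (n - i) / fact (n - i)))" for n
  have exp_ge: "(\<Sum>j\<le>N. x ^ j / fact j) \<le> exp x" if "0 \<le> x" for x :: real and N
  proof -
    have "(\<Sum>j\<le>N. x ^ j / fact j) \<le> (\<Sum>j. x ^ j / fact j)"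
      using that summable_exp[of x] by (intro sum_le_suminf) (auto simp: field_simps)
    thus ?thesis by (simp add: exp_def divide_inverse_commute scaleR_conv_of_real mult.commute)
  qed
  have partial: "(\<Sum>n<N. b n) \<le> exp (z * exp z)" for N
  proof -
    have "(\<Sum>n<N. b n)
        = (\<Sum>(i, j)\<in>{(i, j). i + j < N}. (z ^ i / fact i) * ((real i * z) ^ j / fact j))"
      unfolding b_def by (subst sum.triangle_reindex) auto
    also have "\<dots> \<le> (\<Sum>(i, j)\<in>{..N} \<times> {..N}. (z ^ i / fact i) * ((real i * z) ^ j / fact j))"
      using assms by (intro sum_mono2) auto
    also have "\<dots> = (\<Sum>i\<le>N. (z ^ i / fact i) * (\<Sum>j\<le>N. (real i * z) ^ j / fact j))"
      by (simp add: sum.cartesian_product sum_distrib_left)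
    also have "\<dots> \<le> (\<Sum>i\<le>N. (z ^ i / fact i) * exp (real i * z))"
      using assms by (intro sum_mono mult_left_mono exp_ge) auto
    also have "\<dots> = (\<Sum>i\<le>N. (z * exp z) ^ i / fact i)"
      by (simp add: power_mult_distrib exp_of_nat_mult)
    also have "\<dots> \<le> exp (z * exp z)"
      using assms by (intro exp_ge) auto
    finally show ?thesis .
  qed
  have b_nonneg: "0 \<le> b n" for n
    unfolding b_def using assms by (intro sum_nonneg) auto
  have "summable b"
    using b_nonneg partial by (intro summableI_nonneg_bounded)
  hence lim: "b \<longlonglongrightarrow> 0" by (rule summable_LIMSEQ_zero)
  have le: "z ^ n * (\<Sum>i\<le>n. real i ^ (n - i)) / fact n \<le> b n" for n
  proof -
    have "z ^ n * (\<Sum>i\<le>n. real i ^ (n - i)) / fact n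
        = (\<Sum>i\<le>n. z ^ n * real i ^ (n - i) / fact n)"
      by (simp add: sum_distrib_left sum_divide_distrib)
    also have "\<dots> \<le> b n" unfolding b_def
    proof (rule sum_mono)
      fix i assume i: "i \<in> {..n}"
      have "fact i * fact (n - i) dvd (fact n :: nat)"
        using i fact_fact_dvd_fact[of i "n - i"] by simp
      hence "fact i * fact (n - i) \<le> (fact n :: nat)" by (rule dvd_imp_le) simp
      hence f: "fact i * fact (n - i) \<le> (fact n :: real)"
        by (metis of_nat_fact of_nat_le_iff of_nat_mult)
      have "z ^ n * real i ^ (n - i) = z ^ i * (real i * z) ^ (n - i)"
        using i by (simp add: power_mult_distrib flip: power_add)
      hence "z ^ n * real i ^ (n - i) / fact n = z ^ i * (real i * z) ^ (n - i) / fact n"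
        by simp
      also have "\<dots> \<le> z ^ i * (real i * z) ^ (n - i) / (fact i * fact (n - i))"
        using assms f by (intro divide_left_mono) auto
      finally show "z ^ n * real i ^ (n - i) / fact n
          \<le> z ^ i / fact i * ((real i * z) ^ (n - i) / fact (n - i))" by simp
    qed
    finally show ?thesis .
  qed
  show ?thesis
    by (rule tendsto_sandwich[OF _ _ tendsto_const lim])
       (use assms le in \<open>auto intro!: always_eventually divide_nonneg_nonneg mult_nonneg_nonneg sum_nonneg\<close>)
qed

text \<open>A Taylor polynomial of sin(t \<surd>w) / (t \<surd>w). Since sine is odd, only integer
  powers of w occur, so its expectation is a combination of moments.\<close>

definition sinc_poly :: "nat \<Rightarrow> real \<Rightarrow> real \<Rightarrow> real" where
  "sinc_poly r t w = (\<Sum>j<r. (-1) ^ j * t ^ (2 * j) / fact (2 * j + 1) * w ^ j)"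

text \<open>The cut at \<open>2 * r + 1\<close> includes the vanishing coefficient of index 2r. Thus
  the Maclaurin remainder has order 2r + 1 and, after division by t \<surd>w, becomes a multiple of
  w^r.\<close>

lemma sin_taylor_sinc_poly:
  assumes "0 \<le> w"
  shows "(\<Sum>k<2 * r + 1. sin_coeff k * (t * sqrt w) ^ k) = t * sqrt w * sinc_poly r t w"
proof (induction r)
  case 0
  thus ?case by (simp add: sinc_poly_def sin_coeff_def)
next
  case (Suc r)
  have "(\<Sum>k<2 * Suc r + 1. sin_coeff k * (t * sqrt w) ^ k)
      = (\<Sum>k<2 * r + 1. sin_coeff k * (t * sqrt w) ^ k)
        + sin_coeff (2 * r + 1) * (t * sqrt w) ^ (2 * r + 1)"
    by (simp add: sin_coeff_def)
  also have "sin_coeff (2 * r + 1) * (t * sqrt w) ^ (2 * r + 1)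
      = t * sqrt w * ((-1) ^ r * t ^ (2 * r) / fact (2 * r + 1) * w ^ r)"
    using assms by (simp add: sin_coeff_def power_mult_distrib power_mult del: fact_Suc)
  finally show ?case
    using Suc by (simp add: sinc_poly_def distrib_left del: fact_Suc)
qed

text \<open>Integrality separates 0 from the other values: if w is positive, then y = t \<surd>w is
  at least t and |sin y / y| is at most 1 / t. The second term is the Maclaurin remainder divided by
  y.\<close>

lemma sinc_poly_approx:
  fixes w :: nat
  assumes "0 < t"
  shows "\<bar>of_bool (w = 0) - sinc_poly r t w\<bar> \<le> 1 / t + t ^ (2 * r) * real w ^ r / fact (2 * r + 1)"
proof (cases "w = 0")
  case True
  show ?thesis
  proof (cases r)
    \<comment> \<open>The empty polynomial errs by 1, which the remainder term covers because 0^0 =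
      1.\<close>
    case 0
    thus ?thesis using True assms by (simp add: sinc_poly_def)
  next
    case (Suc r')
    have "sinc_poly r t 0 = 1"
      unfolding sinc_poly_def Suc
      by (subst sum.lessThan_Suc_shift) (simp add: power_0_left)
    thus ?thesis using True assms Suc by simp
  qed
next
  case False
  define y where "y = t * sqrt (real w)"
  have w1: "1 \<le> sqrt (real w)" using False by simp
  have y: "0 < y" "t \<le> y" using assms w1 by (auto simp: y_def)
  have "\<bar>sin y - y * sinc_poly r t w\<bar> \<le> inverse (fact (2 * r + 1)) * \<bar>y\<bar> ^ (2 * r + 1)"
    using Maclaurin_sin_bound[of y "2 * r + 1"] sin_taylor_sinc_poly[of "real w" t r]
    by (simp add: y_def del: fact_Suc)
  hence "\<bar>sin y - y * sinc_poly r t w\<bar> / y \<le> (inverse (fact (2 * r + 1)) * \<bar>y\<bar> ^ (2 * r + 1)) / y"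
    using y by (intro divide_right_mono) auto
  also have "\<dots> = y ^ (2 * r) / fact (2 * r + 1)"
    using y by (simp add: field_simps del: fact_Suc)
  also have "y ^ (2 * r) = t ^ (2 * r) * real w ^ r"
    by (simp add: y_def power_mult_distrib power_mult)
  also have "\<bar>sin y - y * sinc_poly r t w\<bar> / y = \<bar>sin y / y - sinc_poly r t w\<bar>"
    using y by (simp add: abs_if field_simps)
  finally have 1: "\<bar>sin y / y - sinc_poly r t w\<bar> \<le> t ^ (2 * r) * real w ^ r / fact (2 * r + 1)" .
  have "\<bar>sin y\<bar> / y \<le> 1 / t"
    using y assms by (intro frac_le) auto
  hence "\<bar>sin y / y\<bar> \<le> 1 / t" using y by simp
  moreover have "of_bool (w = 0) - sinc_poly r t w = - sinc_poly r t w" using False by simp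
  ultimately show ?thesis using 1 by linarith
qed

subsection \<open>Random sets with independent small subsets\<close>

definition num_contained :: "'v set set \<Rightarrow> 'v set \<Rightarrow> nat" where
  "num_contained F S = card {e \<in> F. e \<subseteq> S}"

text \<open>The mean of \<open>of_bool (V \<subseteq> S) * real (num_contained F S) ^ r\<close> if
  small sets U lie in S with probability \<open>q ^ card U\<close>. Each step expands one factor
  into a sum over F. No distribution is mentioned, so different ones can share the value.\<close>

primrec moment :: "'v set set \<Rightarrow> real \<Rightarrow> nat \<Rightarrow> 'v set \<Rightarrow> real" where
  "moment F q 0 V = q ^ card V"
| "moment F q (Suc r) V = (\<Sum>e\<in>F. moment F q r (V \<union> e))"

lemma num_contained_eq_sum:
  "finite F \<Longrightarrow> real (num_contained F S) = (\<Sum>e\<in>F. of_bool (e \<subseteq> S))"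
  by (simp add: num_contained_def of_bool_def sum.If_cases Int_def)

lemma card_Un_eq_add_diff:
  "finite V \<Longrightarrow> finite e \<Longrightarrow> card (V \<union> e) = card V + card (e - V)"
  by (metis Un_Diff_cancel card_Un_disjoint Diff_disjoint finite_Diff)

text \<open>
  The index \<open>i\<close> is the number of vertices gained in \<open>r\<close> steps of \<open>moment\<close> from a set of size \<open>s\<close>: a step that
  gains \<open>j\<close> vertices in the presence of \<open>s\<close> has at most a constant times \<open>s ^ (2 - j) / q ^ j\<close> choices.
\<close>

definition walk_weight :: "nat \<Rightarrow> nat \<Rightarrow> real" where
  "walk_weight r s = (\<Sum>i\<le>2 * r. real (s + i) ^ (2 * r - i))"

lemma walk_weight_nonneg: "0 \<le> walk_weight r s"
  unfolding walk_weight_def by (intro sum_nonneg) auto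

text \<open>When d vertices are gained, the index i becomes i + d and the exponent rises by 2 - d;
  the extra powers of s + i + d absorb the number of choices, here s^2.\<close>

lemma walk_weight_step0: "real s ^ 2 * walk_weight r s \<le> walk_weight (Suc r) s"
proof -
  have "real s ^ 2 * walk_weight r s \<le> (\<Sum>i\<le>2 * r. real (s + i) ^ (2 * Suc r - i))"
    unfolding walk_weight_def sum_distrib_left
  proof (rule sum_mono)
    fix i assume i: "i \<in> {..2 * r}"
    have "real s ^ 2 * real (s + i) ^ (2 * r - i) \<le> real (s + i) ^ 2 * real (s + i) ^ (2 * r - i)"
      by (intro mult_right_mono power_mono) auto
    also have "\<dots> = real (s + i) ^ (2 * Suc r - i)"
      using i by (subst power_add[symmetric], intro arg_cong[where f = "\<lambda>k. real (s + i) ^ k"]) auto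
    finally show "real s ^ 2 * real (s + i) ^ (2 * r - i) \<le> real (s + i) ^ (2 * Suc r - i)" .
  qed
  also have "\<dots> \<le> walk_weight (Suc r) s"
    unfolding walk_weight_def by (intro sum_mono2) auto
  finally show ?thesis .
qed

lemma walk_weight_shift:
  "(\<Sum>i\<le>2 * r. real (s + (i + d)) ^ (2 * Suc r - (i + d))) \<le> walk_weight (Suc r) s" if "d \<le> 2"
proof -
  have "(\<Sum>i\<le>2 * r. real (s + (i + d)) ^ (2 * Suc r - (i + d)))
      = (\<Sum>j\<in>(\<lambda>i. i + d) ` {..2 * r}. real (s + j) ^ (2 * Suc r - j))"
    by (subst sum.reindex) (auto simp: inj_on_def)
  also have "\<dots> \<le> walk_weight (Suc r) s"
    unfolding walk_weight_def using that by (intro sum_mono2) auto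
  finally show ?thesis .
qed

text \<open>The single extra factor s + i + 1 dominates both s and 1, as needed for the two parts of
  \<open>L + K * real (card V)\<close> in \<open>moment_le\<close>.\<close>

lemma walk_weight_step1:
  "real s * walk_weight r (s + 1) \<le> walk_weight (Suc r) s"
  "walk_weight r (s + 1) \<le> walk_weight (Suc r) s"
proof -
  have *: "real (s + (i + 1)) * real (s + 1 + i) ^ (2 * r - i) = real (s + (i + 1)) ^ (2 * Suc r - (i + 1))"
    if "i \<le> 2 * r" for i
  proof -
    have "2 * Suc r - (i + 1) = Suc (2 * r - i)" using that by simp
    thus ?thesis by (simp add: add_ac)
  qed
  have "a * walk_weight r (s + 1) \<le> walk_weight (Suc r) s" if a: "a \<le> real (s + 1)" for a
  proof -
    have "a * walk_weight r (s + 1) \<le> (\<Sum>i\<le>2 * r. real (s + (i + 1)) ^ (2 * Suc r - (i + 1)))"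
      unfolding walk_weight_def sum_distrib_left
    proof (rule sum_mono)
      fix i assume i: "i \<in> {..2 * r}"
      have "a * real (s + 1 + i) ^ (2 * r - i) \<le> real (s + (i + 1)) * real (s + 1 + i) ^ (2 * r - i)"
        using a by (intro mult_right_mono) auto
      also have "\<dots> = real (s + (i + 1)) ^ (2 * Suc r - (i + 1))"
        using i * by simp
      finally show "a * real (s + 1 + i) ^ (2 * r - i) \<le> real (s + (i + 1)) ^ (2 * Suc r - (i + 1))" .
    qed
    also have "\<dots> \<le> walk_weight (Suc r) s" by (rule walk_weight_shift) simp
    finally show ?thesis .
  qed
  from this[of "real s"] this[of 1] show "real s * walk_weight r (s + 1) \<le> walk_weight (Suc r) s"
    "walk_weight r (s + 1) \<le> walk_weight (Suc r) s" by auto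
qed

lemma walk_weight_step2: "walk_weight r (s + 2) \<le> walk_weight (Suc r) s"
proof -
  have "walk_weight r (s + 2) = (\<Sum>i\<le>2 * r. real (s + (i + 2)) ^ (2 * Suc r - (i + 2)))"
    unfolding walk_weight_def by (intro sum.cong) (auto simp: add_ac)
  also have "\<dots> \<le> walk_weight (Suc r) s" by (rule walk_weight_shift) simp
  finally show ?thesis .
qed

text \<open>Induction on r, splitting F by the number j of vertices that e adds to V. These cost a
  factor \<open>q ^ j\<close>, which \<open>n1\<close> and \<open>n2\<close> weigh against the
  number of such e. The classes j = 0, 1, 2 contribute the summands 1, L + K and M of the
  constant.\<close>

lemma moment_le:
  fixes F :: "'v set set"
  assumes fin: "finite A" and q: "0 < q"
    and F: "\<forall>e\<in>F. e \<subseteq> A \<and> card e \<le> 2"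
    and n0: "\<And>V. V \<subseteq> A \<Longrightarrow> real (card {e \<in> F. e \<subseteq> V}) \<le> real (card V) ^ 2"
    and n1: "\<And>V. V \<subseteq> A \<Longrightarrow> real (card {e \<in> F. card (e - V) = 1}) * q \<le> L + K * real (card V)"
    and n2: "\<And>V. V \<subseteq> A \<Longrightarrow> real (card {e \<in> F. card (e - V) = 2}) * q ^ 2 \<le> M"
    and nonneg: "0 \<le> L" "0 \<le> K" "0 \<le> M" and V: "V \<subseteq> A"
  shows "moment F q r V \<le> q ^ card V * ((1 + L + K + M) ^ r * walk_weight r (card V))"
  using V
proof (induction r arbitrary: V)
  case 0
  thus ?case by (simp add: walk_weight_def)
next
  case (Suc r)
  define C where "C = 1 + L + K + M"
  define s where "s = card V"
  define N where "N j = {e \<in> F. card (e - V) = j}" for j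
  \<comment> \<open>The bound of the induction hypothesis for a set of s + j vertices.\<close>
  define g where "g j = q ^ (s + j) * (C ^ r * walk_weight r (s + j))" for j
  have C: "0 \<le> C" using nonneg by (simp add: C_def)
  have finF: "finite F" using F fin by (intro finite_subset[of F "Pow A"]) auto
  have finV: "finite V" using Suc.prems fin finite_subset by blast
  have fine: "finite e" if "e \<in> F" for e using F[rule_format, OF that] fin finite_subset by blast
  have F_eq: "F = N 0 \<union> N 1 \<union> N 2"
  proof -
    have "card (e - V) = 0 \<or> card (e - V) = 1 \<or> card (e - V) = 2" if "e \<in> F" for e
    proof -
      have "card (e - V) \<le> card e" using fine[OF that] by (intro card_mono) auto
      thus ?thesis using F[rule_format, OF that] by linarith
    qed
    thus ?thesis unfolding N_def by blast
  qed
  have N0: "N 0 = {e \<in> F. e \<subseteq> V}" using fine by (auto simp: N_def)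
  have finN: "finite (N j)" for j using finF by (simp add: N_def)
  have "moment F q (Suc r) V \<le> (\<Sum>e\<in>F. g (card (e - V)))"
    unfolding moment.simps
  proof (rule sum_mono)
    fix e assume e: "e \<in> F"
    have "moment F q r (V \<union> e)
        \<le> q ^ card (V \<union> e) * ((1 + L + K + M) ^ r * walk_weight r (card (V \<union> e)))"
      using Suc.prems F[rule_format, OF e] by (intro Suc.IH) auto
    thus "moment F q r (V \<union> e) \<le> g (card (e - V))"
      using card_Un_eq_add_diff[OF finV fine[OF e]] by (simp add: g_def C_def s_def)
  qed
  also have "\<dots> = (\<Sum>e\<in>N 0. g (card (e - V))) + (\<Sum>e\<in>N 1. g (card (e - V))) + (\<Sum>e\<in>N 2. g (card (e - V)))"
    unfolding F_eq using finN by (subst sum.union_disjoint; (subst sum.union_disjoint)?) (auto simp: N_def)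
  also have "\<dots> = real (card (N 0)) * g 0 + real (card (N 1)) * g 1 + real (card (N 2)) * g 2"
    by (simp add: N_def)
  also have "real (card (N 0)) * g 0 \<le> q ^ s * (C ^ r * walk_weight (Suc r) s)"
  proof -
    have "real (card (N 0)) * g 0 \<le> real s ^ 2 * g 0"
      using n0[OF Suc.prems] q C walk_weight_nonneg[of r s]
      by (intro mult_right_mono) (auto simp: g_def N0 s_def)
    also have "\<dots> = q ^ s * (C ^ r * (real s ^ 2 * walk_weight r s))" by (simp add: g_def)
    also have "\<dots> \<le> q ^ s * (C ^ r * walk_weight (Suc r) s)"
      using q C walk_weight_step0[of s r] by (intro mult_left_mono) auto
    finally show ?thesis .
  qed
  also have "real (card (N 1)) * g 1 \<le> q ^ s * (C ^ r * ((L + K) * walk_weight (Suc r) s))"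
  proof -
    have "real (card (N 1)) * g 1 = (real (card (N 1)) * q) * (q ^ s * (C ^ r * walk_weight r (s + 1)))"
      by (simp add: g_def)
    also have "\<dots> \<le> (L + K * real s) * (q ^ s * (C ^ r * walk_weight r (s + 1)))"
      using n1[OF Suc.prems] q C walk_weight_nonneg[of r "s + 1"]
      by (intro mult_right_mono) (auto simp: N_def s_def)
    also have "\<dots> = q ^ s * (C ^ r * (L * walk_weight r (s + 1) + K * (real s * walk_weight r (s + 1))))"
      by (simp add: algebra_simps)
    also have "\<dots> \<le> q ^ s * (C ^ r * (L * walk_weight (Suc r) s + K * walk_weight (Suc r) s))"
      using q C nonneg walk_weight_step1[of r s] walk_weight_step1[of s r]
      by (intro mult_left_mono add_mono) auto
    finally show ?thesis by (simp add: algebra_simps)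
  qed
  also have "real (card (N 2)) * g 2 \<le> q ^ s * (C ^ r * (M * walk_weight (Suc r) s))"
  proof -
    have "real (card (N 2)) * g 2 = (real (card (N 2)) * q ^ 2) * (q ^ s * (C ^ r * walk_weight r (s + 2)))"
      by (simp add: g_def power_add power2_eq_square)
    also have "\<dots> \<le> M * (q ^ s * (C ^ r * walk_weight r (s + 2)))"
      using n2[OF Suc.prems] q C walk_weight_nonneg[of r "s + 2"]
      by (intro mult_right_mono) (auto simp: N_def s_def)
    also have "\<dots> = q ^ s * (C ^ r * (M * walk_weight r (s + 2)))" by simp
    also have "\<dots> \<le> q ^ s * (C ^ r * (M * walk_weight (Suc r) s))"
      using q C nonneg walk_weight_step2[of r s] by (intro mult_left_mono) auto
    finally show ?thesis .
  qed
  finally have "moment F q (Suc r) V \<le> q ^ s * (C ^ r * walk_weight (Suc r) s)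
      + q ^ s * (C ^ r * ((L + K) * walk_weight (Suc r) s))
      + q ^ s * (C ^ r * (M * walk_weight (Suc r) s))" by simp
  also have "\<dots> = q ^ s * (C ^ Suc r * walk_weight (Suc r) s)"
    by (simp add: C_def algebra_simps)
  finally show ?case by (simp add: C_def s_def)
qed

section \<open>Moments and Chebyshev's inequality under limited independence\<close>

lemma prob_eq_expectation:
  "measure_pmf.prob Q {S. P S} = measure_pmf.expectation Q (\<lambda>S. of_bool (P S))"
proof -
  have "(\<lambda>S. of_bool (P S)) = (indicator {S. P S} :: _ \<Rightarrow> real)"
    by (auto simp: fun_eq_iff indicator_def)
  thus ?thesis by simp
qed

text \<open>Only the probabilities of V \<subseteq> S for small V are prescribed: the low moments of
  \<open>num_contained\<close> depend on nothing else.\<close>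

locale kwise_random_subset =
  fixes Q :: "'v set pmf" and A :: "'v set" and q :: real and c :: nat
  assumes finite_A: "finite A" and set_pmf_subset: "set_pmf Q \<subseteq> Pow A"
    and q: "0 < q" "q \<le> 1"
    and prob_superset: "\<And>V. V \<subseteq> A \<Longrightarrow> card V \<le> c \<Longrightarrow> measure_pmf.prob Q {S. V \<subseteq> S} = q ^ card V"
begin

lemma integrable_Q [simp, intro]: "integrable (measure_pmf Q) (g :: 'v set \<Rightarrow> real)"
  using finite_A set_pmf_subset by (intro integrable_measure_pmf_finite) (auto intro: finite_subset)

lemma expectation_mono:
  "(\<And>S. g S \<le> h S) \<Longrightarrow> measure_pmf.expectation Q g \<le> measure_pmf.expectation Q (h :: 'v set \<Rightarrow> real)"
  by (intro integral_mono) auto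

text \<open>Each factor merges one set e into V; r of them add at most 2r vertices, which stays
  within the order c.\<close>

lemma expectation_num_contained:
  assumes F: "\<forall>e\<in>F. e \<subseteq> A \<and> card e \<le> 2" and "V \<subseteq> A" and "card V + 2 * r \<le> c"
  shows "measure_pmf.expectation Q (\<lambda>S. of_bool (V \<subseteq> S) * real (num_contained F S) ^ r) = moment F q r V"
  using assms(2,3)
proof (induction r arbitrary: V)
  case 0
  thus ?case using prob_superset[of V] by (simp add: prob_eq_expectation)
next
  case (Suc r)
  have finF: "finite F" using F finite_A by (intro finite_subset[of F "Pow A"]) auto
  have "(\<lambda>S. of_bool (V \<subseteq> S) * real (num_contained F S) ^ Suc r)
      = (\<lambda>S. \<Sum>e\<in>F. of_bool (V \<union> e \<subseteq> S) * real (num_contained F S) ^ r)"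
  proof
    fix S
    have "of_bool (V \<subseteq> S) * real (num_contained F S) ^ Suc r
        = (\<Sum>e\<in>F. of_bool (V \<subseteq> S) * of_bool (e \<subseteq> S)) * real (num_contained F S) ^ r"
      using num_contained_eq_sum[OF finF, of S] by (simp flip: sum_distrib_left)
    thus "of_bool (V \<subseteq> S) * real (num_contained F S) ^ Suc r
        = (\<Sum>e\<in>F. of_bool (V \<union> e \<subseteq> S) * real (num_contained F S) ^ r)"
      by (simp add: sum_distrib_right of_bool_conj)
  qed
  hence "measure_pmf.expectation Q (\<lambda>S. of_bool (V \<subseteq> S) * real (num_contained F S) ^ Suc r)
      = (\<Sum>e\<in>F. measure_pmf.expectation Q (\<lambda>S. of_bool (V \<union> e \<subseteq> S) * real (num_contained F S) ^ r))"
    by (simp only: Bochner_Integration.integral_sum integrable_Q)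
  also have "\<dots> = (\<Sum>e\<in>F. moment F q r (V \<union> e))"
  proof (rule sum.cong[OF refl])
    fix e assume e: "e \<in> F"
    have "card (V \<union> e) \<le> card V + card e" by (rule card_Un_le)
    with F[rule_format, OF e] Suc.prems show "measure_pmf.expectation Q
        (\<lambda>S. of_bool (V \<union> e \<subseteq> S) * real (num_contained F S) ^ r) = moment F q r (V \<union> e)"
      by (intro Suc.IH) auto
  qed
  finally show ?case by simp
qed

text \<open>Chebyshev's inequality, restricted to the event \<open>V \<subseteq> S\<close>.\<close>

lemma prob_none_contained_le:
  assumes F: "\<forall>e\<in>F. e \<subseteq> A \<and> card e \<le> 2" and V: "V \<subseteq> A" "card V + 4 \<le> c"
    and w: "\<And>e. e \<in> F \<Longrightarrow> card (e - V) = w"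
    and \<mu>: "\<mu> = real (card F) * q ^ w" "0 < \<mu>"
    and \<beta>: "\<And>e. e \<in> F \<Longrightarrow> (\<Sum>e'\<in>F. q ^ card (e' - (V \<union> e))) \<le> \<mu> + \<beta>"
  shows "measure_pmf.prob Q {S. V \<subseteq> S \<and> (\<forall>e\<in>F. \<not> e \<subseteq> S)} \<le> q ^ card V * \<beta> / \<mu>"
proof -
  let ?E = "measure_pmf.expectation Q"
  define s where "s = card V"
  have finF: "finite F" using F finite_A by (intro finite_subset[of F "Pow A"]) auto
  have fin: "finite U" if "U \<subseteq> A" for U using finite_A that finite_subset by blast
  have fine: "finite e" if "e \<in> F" for e using F[rule_format, OF that] fin by blast
  have m0: "?E (\<lambda>S. of_bool (V \<subseteq> S)) = q ^ s"
    using expectation_num_contained[OF F V(1), of 0] V(2) by (simp add: s_def)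
  have m1: "?E (\<lambda>S. of_bool (V \<subseteq> S) * real (num_contained F S)) = q ^ s * \<mu>"
  proof -
    have "?E (\<lambda>S. of_bool (V \<subseteq> S) * real (num_contained F S)) = (\<Sum>e\<in>F. q ^ card (V \<union> e))"
      using expectation_num_contained[OF F V(1), of "Suc 0"] V(2) by simp
    also have "\<dots> = (\<Sum>e\<in>F. q ^ (s + w))"
      using w fin[OF V(1)] fine by (intro sum.cong) (auto simp: card_Un_eq_add_diff s_def)
    finally show ?thesis by (simp add: \<mu>(1) power_add)
  qed
  \<comment> \<open>Two factors of the count add up to 4 vertices to V, hence
    \<open>card V + 4 \<le> c\<close>.\<close>
  have m2: "?E (\<lambda>S. of_bool (V \<subseteq> S) * real (num_contained F S) ^ 2) \<le> q ^ s * (\<mu> * (\<mu> + \<beta>))"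
  proof -
    have "?E (\<lambda>S. of_bool (V \<subseteq> S) * real (num_contained F S) ^ 2) = moment F q 2 V"
      using V by (intro expectation_num_contained[OF F]) auto
    also have "\<dots> = (\<Sum>e\<in>F. \<Sum>e'\<in>F. q ^ card (V \<union> e \<union> e'))"
      by (simp add: numeral_2_eq_2)
    \<comment> \<open>The inner sum is the mean count given V \<union> e \<subseteq> S; \<beta>
      bounds its excess over \<mu>.\<close>
    also have "\<dots> = (\<Sum>e\<in>F. q ^ (s + w) * (\<Sum>e'\<in>F. q ^ card (e' - (V \<union> e))))"
      unfolding sum_distrib_left
      using w fin[OF V(1)] fine
      by (intro sum.cong) (auto simp: card_Un_eq_add_diff s_def power_add)
    also have "\<dots> \<le> (\<Sum>e\<in>F. q ^ (s + w) * (\<mu> + \<beta>))"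
      using q \<beta> by (intro sum_mono mult_left_mono) auto
    finally show ?thesis by (simp add: \<mu>(1) power_add mult_ac)
  qed
  have "\<mu>\<^sup>2 * measure_pmf.prob Q {S. V \<subseteq> S \<and> (\<forall>e\<in>F. \<not> e \<subseteq> S)}
      = ?E (\<lambda>S. \<mu>\<^sup>2 * of_bool (V \<subseteq> S \<and> (\<forall>e\<in>F. \<not> e \<subseteq> S)))"
    by (simp add: prob_eq_expectation)
  \<comment> \<open>On the event the count is 0, so its squared deviation from \<mu> is
    \<mu>^2.\<close>
  also have "\<dots> \<le> ?E (\<lambda>S. of_bool (V \<subseteq> S) * (real (num_contained F S) - \<mu>)\<^sup>2)"
  proof (rule expectation_mono)
    fix S
    have "num_contained F S = 0" if "\<forall>e\<in>F. \<not> e \<subseteq> S"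
      using that unfolding num_contained_def by (auto intro!: card_eq_0_iff[THEN iffD2])
    thus "\<mu>\<^sup>2 * of_bool (V \<subseteq> S \<and> (\<forall>e\<in>F. \<not> e \<subseteq> S)) \<le> of_bool (V \<subseteq> S) * (real (num_contained F S) - \<mu>)\<^sup>2"
      by (auto simp: of_bool_def)
  qed
  also have "\<dots> = ?E (\<lambda>S. of_bool (V \<subseteq> S) * real (num_contained F S) ^ 2
      - 2 * \<mu> * (of_bool (V \<subseteq> S) * real (num_contained F S)) + \<mu>\<^sup>2 * of_bool (V \<subseteq> S))"
    by (intro arg_cong[where f = ?E]) (simp add: fun_eq_iff power2_eq_square algebra_simps)
  also have "\<dots> = ?E (\<lambda>S. of_bool (V \<subseteq> S) * real (num_contained F S) ^ 2) - 2 * \<mu> * (q ^ s * \<mu>) + \<mu>\<^sup>2 * q ^ s"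
    using m0 m1 by simp
  also have "\<dots> \<le> q ^ s * (\<mu> * (\<mu> + \<beta>)) - 2 * \<mu> * (q ^ s * \<mu>) + \<mu>\<^sup>2 * q ^ s"
    using m2 by simp
  also have "\<dots> = \<mu>\<^sup>2 * (q ^ s * \<beta> / \<mu>)"
    using \<mu>(2) by (simp add: field_simps power2_eq_square)
  finally show ?thesis using \<mu>(2) by (simp only: s_def mult_le_cancel_left_pos zero_less_power)
qed

text \<open>The expectation of \<open>sinc_poly_approx\<close>. Both the approximating sum and the
  error involve Q only through \<open>moment\<close>, hence agree for all distributions with the
  same q.\<close>

lemma prob_num_contained_0_approx:
  assumes F: "\<forall>e\<in>F. e \<subseteq> A \<and> card e \<le> 2" and "2 * r \<le> c" and t: "0 < t"
  shows "\<bar>measure_pmf.prob Q {S. num_contained F S = 0}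
           - (\<Sum>j<r. (-1) ^ j * t ^ (2 * j) / fact (2 * j + 1) * moment F q j {})\<bar>
         \<le> 1 / t + t ^ (2 * r) / fact (2 * r + 1) * moment F q r {}"
proof -
  let ?E = "measure_pmf.expectation Q"
  have m: "?E (\<lambda>S. real (num_contained F S) ^ j) = moment F q j {}" if "j \<le> r" for j
    using expectation_num_contained[OF F, of "{}" j] that assms(2) by simp
  have "?E (\<lambda>S. sinc_poly r t (num_contained F S))
      = (\<Sum>j<r. (-1) ^ j * t ^ (2 * j) / fact (2 * j + 1) * moment F q j {})"
    unfolding sinc_poly_def
    by (subst Bochner_Integration.integral_sum) (auto simp: m simp del: fact_Suc intro!: sum.cong)
  hence "measure_pmf.prob Q {S. num_contained F S = 0}
           - (\<Sum>j<r. (-1) ^ j * t ^ (2 * j) / fact (2 * j + 1) * moment F q j {})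
      = ?E (\<lambda>S. of_bool (num_contained F S = 0) - sinc_poly r t (num_contained F S))"
    by (simp add: prob_eq_expectation)
  also have "\<bar>\<dots>\<bar> \<le> ?E (\<lambda>S. \<bar>of_bool (num_contained F S = 0) - sinc_poly r t (num_contained F S)\<bar>)"
    by (rule integral_abs_bound)
  also have "\<dots> \<le> ?E (\<lambda>S. 1 / t + t ^ (2 * r) / fact (2 * r + 1) * real (num_contained F S) ^ r)"
  proof (rule expectation_mono)
    fix S
    show "\<bar>of_bool (num_contained F S = 0) - sinc_poly r t (num_contained F S)\<bar>
        \<le> 1 / t + t ^ (2 * r) / fact (2 * r + 1) * real (num_contained F S) ^ r"
      using sinc_poly_approx[OF t, of "num_contained F S" r] by (simp del: fact_Suc)
  qed
  also have "\<dots> = 1 / t + t ^ (2 * r) / fact (2 * r + 1) * moment F q r {}"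
    by (simp add: m del: fact_Suc)
  finally show ?thesis .
qed

end

subsection \<open>Graphs of bounded degree\<close>

text \<open>For an inclusion-maximal E, adding e pushes some degree above D; that vertex must lie on
  e and already have degree D.\<close>

lemma exists_maximal_bounded_degree:
  fixes G :: "'v set set"
  assumes "finite G"
  obtains E where "E \<subseteq> G" "\<And>v. card {e \<in> E. v \<in> e} \<le> D"
    "\<And>e. e \<in> G \<Longrightarrow> e \<notin> E \<Longrightarrow> \<exists>v\<in>e. card {e' \<in> E. v \<in> e'} = D"
proof -
  define P where "P = {E. E \<subseteq> G \<and> (\<forall>v. card {e \<in> E. v \<in> e} \<le> D)}"
  have "finite P" using assms by (intro finite_subset[of P "Pow G"]) (auto simp: P_def)
  moreover have "{} \<in> P" by (simp add: P_def)
  ultimately have "\<exists>E\<in>P. \<forall>E'\<in>P. E \<subseteq> E' \<longrightarrow> E = E'"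
    by (intro finite_has_maximal) auto
  then obtain E where E: "E \<in> P" and max: "\<And>E'. E' \<in> P \<Longrightarrow> E \<subseteq> E' \<Longrightarrow> E = E'"
    by blast
  have "E \<subseteq> G" using E by (simp add: P_def)
  hence finE: "finite E" using assms by (rule finite_subset)
  show thesis
  proof (rule that)
    show "E \<subseteq> G" by fact
    show deg: "card {e \<in> E. v \<in> e} \<le> D" for v
      using E by (simp add: P_def)
    fix e assume e: "e \<in> G" "e \<notin> E"
    hence "insert e E \<notin> P" using max[of "insert e E"] by blast
    hence "\<exists>v. D < card {e' \<in> insert e E. v \<in> e'}"
      using e(1) \<open>E \<subseteq> G\<close> unfolding P_def by (simp add: not_le)
    then obtain v where v: "D < card {e' \<in> insert e E. v \<in> e'}" by blast
    have "v \<in> e"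
    proof (rule ccontr)
      assume "v \<notin> e"
      hence "{e' \<in> insert e E. v \<in> e'} = {e' \<in> E. v \<in> e'}" by auto
      thus False using v deg[of v] by simp
    qed
    moreover have "card {e' \<in> insert e E. v \<in> e'} \<le> Suc (card {e' \<in> E. v \<in> e'})"
    proof -
      have "card {e' \<in> insert e E. v \<in> e'} \<le> card (insert e {e' \<in> E. v \<in> e'})"
        using finE by (intro card_mono) auto
      also have "\<dots> \<le> Suc (card {e' \<in> E. v \<in> e'})" by (rule card_insert_le_m1) auto
      finally show ?thesis .
    qed
    ultimately show "\<exists>v\<in>e. card {e' \<in> E. v \<in> e'} = D"
      using v deg[of v] by (intro bexI[of _ v]) auto
  qed
qed

text \<open>Double counting: after swapping the sums, each edge counts its endpoints in H, at most
  two.\<close>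

lemma sum_degrees_le:
  assumes "finite E" "finite H" "\<And>e. e \<in> E \<Longrightarrow> card e = 2"
  shows "(\<Sum>v\<in>H. card {e \<in> E. v \<in> e}) \<le> 2 * card E"
proof -
  have "(\<Sum>v\<in>H. card {e \<in> E. v \<in> e}) = (\<Sum>v\<in>H. \<Sum>e\<in>E. of_bool (v \<in> e))"
    using assms by (simp add: of_bool_def sum.If_cases Int_def)
  also have "\<dots> = (\<Sum>e\<in>E. card (H \<inter> e))"
    using assms by (subst sum.swap) (simp add: of_bool_def sum.If_cases)
  also have "\<dots> \<le> (\<Sum>e\<in>E. 2)"
  proof (rule sum_mono)
    fix e assume "e \<in> E"
    hence "card e = 2" by (rule assms)
    moreover from this have "finite e" by (metis card.infinite zero_neq_numeral)
    ultimately show "card (H \<inter> e) \<le> 2" by (metis card_mono inf_le2)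
  qed
  finally show ?thesis by simp
qed

lemma card_2_diff_eq_1:
  assumes "card e = 2" "card e' = 2" "e \<noteq> e'" "v \<in> e" "v \<in> e'"
  shows "card (e' - e) = 1"
proof -
  obtain a where a: "e = {v, a}" "a \<noteq> v" using assms(1,4) by (auto simp: card_2_iff)
  obtain b where b: "e' = {v, b}" "b \<noteq> v" using assms(2,5) by (auto simp: card_2_iff)
  have "e' - e = {b}" using a b assms(3) by auto
  thus ?thesis by simp
qed

locale bounded_degree_graph =
  fixes A :: "'v set" and E :: "'v set set" and D :: nat
  assumes finite_vertices: "finite A"
    and edges: "\<And>e. e \<in> E \<Longrightarrow> e \<subseteq> A \<and> card e = 2"
    and degree_le: "\<And>v. card {e \<in> E. v \<in> e} \<le> D"
    and D_pos: "0 < D"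
begin

definition saturated :: "'v set" where
  "saturated = {v \<in> A. card {e \<in> E. v \<in> e} = D}"

text \<open>A saturated vertex enters as a singleton, so that the W of the idea is a single count
  \<open>num_contained witnesses S\<close> of sets with at most two vertices.\<close>

definition witnesses :: "'v set set" where
  "witnesses = E \<union> (\<lambda>v. {v}) ` saturated"

lemma finite_edges: "finite E"
  using finite_vertices edges by (intro finite_subset[of E "Pow A"]) auto

lemma finite_saturated: "finite saturated"
  using finite_vertices by (simp add: saturated_def)

lemma witnessesD: "\<forall>e\<in>witnesses. e \<subseteq> A \<and> card e \<le> 2"
proof
  fix e assume "e \<in> witnesses"
  then consider "e \<in> E" | v where "v \<in> A" "e = {v}"
    by (auto simp: witnesses_def saturated_def)
  thus "e \<subseteq> A \<and> card e \<le> 2" using edges[of e] by cases auto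
qed

lemma finite_witnesses: "finite witnesses"
  by (simp add: witnesses_def finite_edges finite_saturated)

lemma card_saturated_le: "card saturated * D \<le> 2 * card E"
proof -
  have "card saturated * D = (\<Sum>v\<in>saturated. card {e \<in> E. v \<in> e})"
    by (simp add: saturated_def)
  thus ?thesis using sum_degrees_le[OF finite_edges finite_saturated] edges by simp
qed

text \<open>An instance of \<open>moment_le\<close>: a witness that adds one vertex to V is a
  saturated singleton or one of at most D edges at some vertex of V; a witness that adds two is an
  edge.\<close>

lemma moment_witnesses_le:
  assumes q: "0 < q" and C: "1 + real (card saturated) * q + real D * q + real (card E) * q ^ 2 \<le> C"
  shows "moment witnesses q r {} \<le> C ^ r * walk_weight r 0"
proof -
  let ?C = "1 + real (card saturated) * q + real D * q + real (card E) * q ^ 2"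
  have "moment witnesses q r {} \<le> q ^ card ({} :: 'v set) * (?C ^ r * walk_weight r (card ({} :: 'v set)))"
  proof (rule moment_le[OF finite_vertices q witnessesD])
    fix V assume V: "V \<subseteq> A"
    have finV: "finite V" using V finite_vertices finite_subset by blast
    show "real (card {e \<in> witnesses. e \<subseteq> V}) \<le> real (card V) ^ 2"
    proof -
      \<comment> \<open>A singleton {v} is the image of the diagonal pair (v, v).\<close>
      have "{e \<in> witnesses. e \<subseteq> V} \<subseteq> (\<lambda>(u, v). {u, v}) ` (V \<times> V)"
      proof
        fix e assume e: "e \<in> {e \<in> witnesses. e \<subseteq> V}"
        then consider "card e = 2" | v where "e = {v}"
          using edges by (auto simp: witnesses_def)
        hence "\<exists>u v. e = {u, v}" by cases (auto simp: card_2_iff)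
        then obtain u v where uv: "e = {u, v}" by blast
        hence "(u, v) \<in> V \<times> V" using e by simp
        thus "e \<in> (\<lambda>(u, v). {u, v}) ` (V \<times> V)" using uv by (intro image_eqI) auto
      qed
      hence "card {e \<in> witnesses. e \<subseteq> V} \<le> card ((\<lambda>(u, v). {u, v}) ` (V \<times> V))"
        using finV by (intro card_mono) auto
      also have "\<dots> \<le> card (V \<times> V)" using finV by (intro card_image_le) auto
      also have "\<dots> = card V ^ 2" by (simp add: card_cartesian_product power2_eq_square)
      finally show ?thesis by (metis of_nat_le_iff of_nat_power)
    qed
    show "real (card {e \<in> witnesses. card (e - V) = 1}) * q
        \<le> real (card saturated) * q + real D * q * real (card V)"
    proof -
      have "{e \<in> witnesses. card (e - V) = 1}
          \<subseteq> (\<lambda>v. {v}) ` saturated \<union> (\<Union>v\<in>V. {e \<in> E. v \<in> e})"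
      proof
        fix e assume e: "e \<in> {e \<in> witnesses. card (e - V) = 1}"
        have "e \<inter> V \<noteq> {}" if "e \<in> E"
        proof
          assume "e \<inter> V = {}"
          hence "e - V = e" by auto
          thus False using e edges[OF that] by simp
        qed
        thus "e \<in> (\<lambda>v. {v}) ` saturated \<union> (\<Union>v\<in>V. {e \<in> E. v \<in> e})"
          using e by (auto simp: witnesses_def)
      qed
      hence "card {e \<in> witnesses. card (e - V) = 1}
          \<le> card ((\<lambda>v. {v}) ` saturated \<union> (\<Union>v\<in>V. {e \<in> E. v \<in> e}))"
        using finV finite_edges finite_saturated by (intro card_mono) auto
      also have "\<dots> \<le> card ((\<lambda>v. {v}) ` saturated) + card (\<Union>v\<in>V. {e \<in> E. v \<in> e})"
        by (rule card_Un_le)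
      also have "\<dots> \<le> card saturated + (\<Sum>v\<in>V. card {e \<in> E. v \<in> e})"
        using finV finite_saturated by (intro add_mono card_image_le card_UN_le) auto
      also have "\<dots> \<le> card saturated + (\<Sum>v\<in>V. D)"
        using degree_le by (intro add_left_mono sum_mono)
      finally have "card {e \<in> witnesses. card (e - V) = 1} \<le> card saturated + card V * D" by simp
      hence "real (card {e \<in> witnesses. card (e - V) = 1}) \<le> real (card saturated + card V * D)"
        by (rule of_nat_mono)
      hence "real (card {e \<in> witnesses. card (e - V) = 1}) * q \<le> real (card saturated + card V * D) * q"
        using q by (intro mult_right_mono) auto
      thus ?thesis by (simp add: algebra_simps)
    qed
    show "real (card {e \<in> witnesses. card (e - V) = 2}) * q ^ 2 \<le> real (card E) * q ^ 2"
    proof -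
      have "e \<in> E" if e: "e \<in> witnesses" "card (e - V) = 2" for e
      proof (rule ccontr)
        assume "e \<notin> E"
        then obtain v where "e = {v}" using e(1) by (auto simp: witnesses_def)
        moreover have "card ({v} - V) \<le> card {v}" by (intro card_mono) auto
        ultimately show False using e(2) by simp
      qed
      hence "card {e \<in> witnesses. card (e - V) = 2} \<le> card E"
        using finite_edges by (intro card_mono) auto
      thus ?thesis by (intro mult_right_mono) auto
    qed
  qed (use q in auto)
  also have "\<dots> = ?C ^ r * walk_weight r 0" by simp
  also have "\<dots> \<le> C ^ r * walk_weight r 0"
    using C q walk_weight_nonneg by (intro mult_right_mono power_mono) auto
  finally show ?thesis .
qed

end

text \<open>Order 5 is what \<open>prob_none_contained_le\<close> demands for V = {v}.\<close>

locale kwise_random_subset_graph = kwise_random_subset Q A q c + bounded_degree_graph A E D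
  for Q :: "'v set pmf" and A q c E D +
  assumes c_ge_5: "5 \<le> c"
begin

text \<open>Chebyshev with V empty. Given an edge e, the excess mean is 1 for e itself plus q for
  each of the at most 2D edges that meet e; disjoint edges give at most the unconditional
  mean.\<close>

lemma prob_no_edge_le:
  assumes "E \<noteq> {}"
  shows "measure_pmf.prob Q {S. \<forall>e\<in>E. \<not> e \<subseteq> S}
           \<le> (1 + 2 * real D * q) / (real (card E) * q ^ 2)"
proof -
  let ?\<mu> = "real (card E) * q ^ 2"
  have "measure_pmf.prob Q {S. {} \<subseteq> S \<and> (\<forall>e\<in>E. \<not> e \<subseteq> S)}
      \<le> q ^ card ({} :: 'v set) * (1 + 2 * real D * q) / ?\<mu>"
  proof (rule prob_none_contained_le[where w = 2])
    show "0 < ?\<mu>" using assms finite_edges q by (simp add: card_gt_0_iff)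
    fix e assume e: "e \<in> E"
    have fe: "finite e" using edges[OF e] finite_vertices finite_subset by blast
    have "(\<Sum>e'\<in>E. q ^ card (e' - ({} \<union> e)))
        \<le> (\<Sum>e'\<in>E. of_bool (e' = e) + (\<Sum>v\<in>e. of_bool (v \<in> e') * q) + q ^ 2)"
    proof (rule sum_mono)
      fix e' assume e': "e' \<in> E"
      have nn: "0 \<le> (\<Sum>v\<in>e. of_bool (v \<in> e') * q)" using q by (intro sum_nonneg) auto
      consider "e' = e" | v where "e' \<noteq> e" "v \<in> e" "v \<in> e'" | "e' \<inter> e = {}" by blast
      thus "q ^ card (e' - ({} \<union> e)) \<le> of_bool (e' = e) + (\<Sum>v\<in>e. of_bool (v \<in> e') * q) + q ^ 2"
      proof cases
        case 1
        thus ?thesis using nn by simp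
      next
        case 2
        have "q = of_bool (v \<in> e') * q" using 2 by simp
        also have "\<dots> \<le> (\<Sum>v\<in>e. of_bool (v \<in> e') * q)"
          using 2 fe q by (intro member_le_sum) auto
        finally show ?thesis
          using card_2_diff_eq_1[of e e' v] 2 edges[OF e] edges[OF e'] by (simp add: add_increasing2)
      next
        case 3
        hence "e' - e = e'" by auto
        thus ?thesis using nn edges[OF e'] by (simp add: add_increasing)
      qed
    qed
    also have "\<dots> = 1 + (\<Sum>v\<in>e. real (card {e' \<in> E. v \<in> e'}) * q) + ?\<mu>"
    proof -
      have "(\<Sum>e'\<in>E. \<Sum>v\<in>e. of_bool (v \<in> e') * q) = (\<Sum>v\<in>e. real (card {e' \<in> E. v \<in> e'}) * q)"
        using finite_edges
        by (subst sum.swap) (simp add: of_bool_def sum.If_cases Int_def flip: sum_distrib_right)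
      thus ?thesis using e finite_edges by (simp add: sum.distrib of_bool_def)
    qed
    also have "\<dots> \<le> 1 + (\<Sum>v\<in>e. real D * q) + ?\<mu>"
      using q degree_le by (intro add_mono sum_mono mult_right_mono) auto
    also have "\<dots> = ?\<mu> + (1 + 2 * real D * q)" using edges[OF e] by simp
    finally show "(\<Sum>e'\<in>E. q ^ card (e' - ({} \<union> e))) \<le> ?\<mu> + (1 + 2 * real D * q)" .
  qed (use edges c_ge_5 in auto)
  thus ?thesis by simp
qed

text \<open>Chebyshev given v, for the D edges at v alone. They lead to distinct neighbours, so the
  mean is \<open>real D * q\<close> with excess 1. The factor q for v \<in> S cancels, leaving 1 / D
  for a union bound.\<close>

lemma prob_saturated_no_edge_le:
  assumes v: "v \<in> saturated"
  shows "measure_pmf.prob Q {S. v \<in> S \<and> (\<forall>e\<in>E. \<not> e \<subseteq> S)} \<le> 1 / real D"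
proof -
  define F where "F = {e \<in> E. v \<in> e}"
  have F: "card F = D" "v \<in> A" using v by (auto simp: F_def saturated_def)
  have finF: "finite F" using finite_edges by (simp add: F_def)
  have "measure_pmf.prob Q {S. v \<in> S \<and> (\<forall>e\<in>E. \<not> e \<subseteq> S)}
      \<le> measure_pmf.prob Q {S. {v} \<subseteq> S \<and> (\<forall>e\<in>F. \<not> e \<subseteq> S)}"
    by (intro measure_pmf.finite_measure_mono) (auto simp: F_def)
  also have "\<dots> \<le> q ^ card {v} * 1 / (real D * q)"
  proof (rule prob_none_contained_le[where w = 1])
    show "0 < real D * q" using D_pos q by simp
    show "card (e - {v}) = 1" if "e \<in> F" for e
      using that edges by (auto simp: F_def card_Diff_singleton)
    fix e assume e: "e \<in> F"
    have "(\<Sum>e'\<in>F. q ^ card (e' - ({v} \<union> e))) \<le> (\<Sum>e'\<in>F. of_bool (e' = e) + q)"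
    proof (rule sum_mono)
      fix e' assume e': "e' \<in> F"
      have "{v} \<union> e = e" using e by (auto simp: F_def)
      thus "q ^ card (e' - ({v} \<union> e)) \<le> of_bool (e' = e) + q"
        using q card_2_diff_eq_1[of e e' v] e e' edges by (cases "e' = e") (auto simp: F_def)
    qed
    also have "\<dots> = real D * q + 1"
      using e finF F by (simp add: sum.distrib of_bool_def)
    finally show "(\<Sum>e'\<in>F. q ^ card (e' - ({v} \<union> e))) \<le> real D * q + 1" .
  qed (use F edges c_ge_5 in \<open>auto simp: F_def\<close>)
  also have "\<dots> = 1 / real D" using q by simp
  finally show ?thesis .
qed

text \<open>By maximality, an edge of G in S yields a witness in S. Conversely, a witness in S
  without an edge of E in S is a saturated vertex, and the union bound applies to these
  failures.\<close>

lemma prob_edge_approx: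
  assumes G: "\<And>e. e \<in> G \<Longrightarrow> e \<subseteq> A" "E \<subseteq> G"
    and max: "\<And>e. e \<in> G \<Longrightarrow> e \<notin> E \<Longrightarrow> \<exists>v\<in>e. card {e' \<in> E. v \<in> e'} = D"
  shows "\<bar>measure_pmf.prob Q {S. \<exists>e\<in>G. e \<subseteq> S} - (1 - measure_pmf.prob Q {S. num_contained witnesses S = 0})\<bar>
           \<le> real (card saturated) / real D"
proof -
  let ?f = "{S. \<exists>e\<in>G. e \<subseteq> S}"
  let ?bad = "\<lambda>v. {S. v \<in> S \<and> (\<forall>e\<in>E. \<not> e \<subseteq> S)}"
  have zero: "num_contained witnesses S = 0 \<longleftrightarrow> (\<forall>e\<in>witnesses. \<not> e \<subseteq> S)" for S
    using finite_witnesses by (auto simp: num_contained_def)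
  have W: "1 - measure_pmf.prob Q {S. num_contained witnesses S = 0}
      = measure_pmf.prob Q {S. \<exists>e\<in>witnesses. e \<subseteq> S}"
    using measure_pmf.prob_compl[of "{S. num_contained witnesses S = 0}" Q]
    by (simp add: zero Compl_eq_Diff_UNIV[symmetric] Collect_neg_eq[symmetric])
  have "?f \<subseteq> {S. \<exists>e\<in>witnesses. e \<subseteq> S}"
  proof
    fix S assume "S \<in> ?f"
    then obtain e where e: "e \<in> G" "e \<subseteq> S" by auto
    show "S \<in> {S. \<exists>e\<in>witnesses. e \<subseteq> S}"
    proof (cases "e \<in> E")
      case True
      thus ?thesis using e by (auto simp: witnesses_def)
    next
      case False
      then obtain v where "v \<in> e" "v \<in> saturated"
        using max[of e] e G(1)[of e] by (auto simp: saturated_def)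
      thus ?thesis using e by (auto simp: witnesses_def intro!: bexI[of _ "{v}"])
    qed
  qed
  hence 1: "measure_pmf.prob Q ?f \<le> measure_pmf.prob Q {S. \<exists>e\<in>witnesses. e \<subseteq> S}"
    by (intro measure_pmf.finite_measure_mono) auto
  have "{S. \<exists>e\<in>witnesses. e \<subseteq> S} \<subseteq> ?f \<union> (\<Union>v\<in>saturated. ?bad v)"
    using subsetD[OF G(2)] unfolding witnesses_def by blast
  hence "measure_pmf.prob Q {S. \<exists>e\<in>witnesses. e \<subseteq> S} \<le> measure_pmf.prob Q (?f \<union> (\<Union>v\<in>saturated. ?bad v))"
    by (intro measure_pmf.finite_measure_mono) auto
  also have "\<dots> \<le> measure_pmf.prob Q ?f + measure_pmf.prob Q (\<Union>v\<in>saturated. ?bad v)"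
    by (intro measure_Un_le) auto
  also have "measure_pmf.prob Q (\<Union>v\<in>saturated. ?bad v) \<le> (\<Sum>v\<in>saturated. measure_pmf.prob Q (?bad v))"
    using finite_saturated by (intro measure_UNION_le) auto
  also have "\<dots> \<le> (\<Sum>v\<in>saturated. 1 / real D)"
    by (intro sum_mono prob_saturated_no_edge_le)
  finally show ?thesis using 1 unfolding W by simp
qed

end

subsection \<open>Bounded independence fools graphs\<close>

text \<open>With z = t \<surd>C, the quantity is at most the term n = 2r of the null sequence in
  \<open>sum_power_over_fact_tendsto_0\<close>.\<close>

lemma exists_moment_order:
  assumes "0 \<le> t" "0 \<le> C" "0 < \<delta>"
  obtains r where "t ^ (2 * r) / fact (2 * r + 1) * (C ^ r * walk_weight r 0) \<le> \<delta>"
proof -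
  define z where "z = t * sqrt C"
  define a where "a n = z ^ n * (\<Sum>i\<le>n. real i ^ (n - i)) / fact n" for n
  have "a \<longlonglongrightarrow> 0"
    unfolding a_def using assms by (intro sum_power_over_fact_tendsto_0) (simp add: z_def)
  hence "eventually (\<lambda>n. a n < \<delta>) sequentially"
    using assms(3) by (rule order_tendstoD)
  then obtain r where r: "\<And>n. r \<le> n \<Longrightarrow> a n < \<delta>" by (auto simp: eventually_sequentially)
  have "t ^ (2 * r) / fact (2 * r + 1) * (C ^ r * walk_weight r 0)
      = z ^ (2 * r) * walk_weight r 0 / fact (2 * r + 1)"
    using assms(2) by (simp add: z_def power_mult_distrib power_mult del: fact_Suc)
  also have "\<dots> \<le> z ^ (2 * r) * walk_weight r 0 / fact (2 * r)"
    using walk_weight_nonneg[of r 0] fact_mono[of "2 * r" "2 * r + 1", where 'a = real]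
    by (intro divide_left_mono mult_nonneg_nonneg) (auto simp: power_mult simp del: fact_Suc)
  also have "\<dots> = a (2 * r)" by (simp add: a_def walk_weight_def)
  also have "\<dots> \<le> \<delta>" using r[of "2 * r"] by simp
  finally show thesis by (rule that)
qed

text \<open>The order c depends on \<eta> alone. Both probabilities are compared with a common
  number: 1 if E has many edges, and 1 - \<sigma> otherwise.\<close>

lemma kwise_fools_graph_dnf:
  assumes "0 < \<eta>"
  obtains c where "\<And>(A :: 'v set) q Q Q' G.
    kwise_random_subset Q A q c \<Longrightarrow> kwise_random_subset Q' A q c \<Longrightarrow>
    (\<And>e. e \<in> G \<Longrightarrow> e \<subseteq> A \<and> card e = 2) \<Longrightarrow>
    \<bar>measure_pmf.prob Q {S. \<exists>e\<in>G. e \<subseteq> S} - measure_pmf.prob Q' {S. \<exists>e\<in>G. e \<subseteq> S}\<bar> \<le> \<eta>"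
proof -
  \<comment> \<open>The sparse case costs twice 3 / t + \<eta> / 4, the dense case 5 / t; both are
    at most \<eta> once 12 / t is.\<close>
  define t where "t = max 1 (12 / \<eta>)"
  have t: "1 \<le> t" "12 / t \<le> \<eta>"
    using assms by (auto simp: t_def max_def field_simps)
  \<comment> \<open>The summands 2t, 2t^2 and t^3 bound \<open>card saturated * q\<close>,
    \<open>D * q\<close> and \<open>card E * q ^ 2\<close> in the sparse case.\<close>
  define C where "C = 1 + 2 * t + 2 * t ^ 2 + t ^ 3"
  obtain r where r: "t ^ (2 * r) / fact (2 * r + 1) * (C ^ r * walk_weight r 0) \<le> \<eta> / 4"
    using exists_moment_order[of t C "\<eta> / 4"] t assms by (auto simp: C_def)
  show thesis
  \<comment> \<open>2r serves the moments up to order r, and 5 Chebyshev's inequality.\<close>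
  proof (rule that[of "2 * r + 5"])
    fix A :: "'v set" and q Q Q' G
    assume Q: "kwise_random_subset Q A q (2 * r + 5)" and Q': "kwise_random_subset Q' A q (2 * r + 5)"
      and G: "\<And>e. e \<in> G \<Longrightarrow> e \<subseteq> A \<and> card e = 2"
    interpret kwise_random_subset Q A q "2 * r + 5" by (rule Q)
    let ?P = "\<lambda>R. measure_pmf.prob R {S. \<exists>e\<in>G. e \<subseteq> S}"
    have finG: "finite G" using G finite_A by (intro finite_subset[of G "Pow A"]) auto
    \<comment> \<open>Rounding up keeps \<open>D * q\<close> between t^2 and 2t^2, as q \<le> 1
      \<le> t^2.\<close>
    define D where "D = nat \<lceil>t ^ 2 / q\<rceil>"
    have "1 \<le> t ^ 2" using t by (simp add: one_le_power)
    have D_ge: "t ^ 2 \<le> real D * q"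
    proof -
      have "t ^ 2 / q \<le> real D" unfolding D_def by (rule real_nat_ceiling_ge)
      thus ?thesis using q by (simp add: field_simps)
    qed
    have D_le: "real D * q \<le> 2 * t ^ 2"
    proof -
      have "0 \<le> t ^ 2 / q" using q by simp
      hence "0 \<le> \<lceil>t ^ 2 / q\<rceil>" by linarith
      hence "real D = of_int \<lceil>t ^ 2 / q\<rceil>" by (simp add: D_def)
      hence "real D \<le> t ^ 2 / q + 1" by linarith
      hence "real D * q \<le> (t ^ 2 / q + 1) * q" using q by (intro mult_right_mono) auto
      also have "\<dots> = t ^ 2 + q" using q by (simp add: field_simps)
      finally show ?thesis using q \<open>1 \<le> t ^ 2\<close> by linarith
    qed
    have D_pos: "0 < D" using D_ge \<open>1 \<le> t ^ 2\<close> by (cases "D = 0") auto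
    obtain E where E: "E \<subseteq> G" "\<And>v. card {e \<in> E. v \<in> e} \<le> D"
      and max: "\<And>e. e \<in> G \<Longrightarrow> e \<notin> E \<Longrightarrow> \<exists>v\<in>e. card {e' \<in> E. v \<in> e'} = D"
      using exists_maximal_bounded_degree[OF finG, of D] by blast
    have E_edges: "e \<subseteq> A \<and> card e = 2" if "e \<in> E" for e using G E(1) that by blast
    have graph: "bounded_degree_graph A E D"
      using finite_A E_edges E(2) D_pos by unfold_locales auto
    interpret bounded_degree_graph A E D by (rule graph)
    have rg: "kwise_random_subset_graph R A q (2 * r + 5) E D"
      if "kwise_random_subset R A q (2 * r + 5)" for R
      using that graph by (simp add: kwise_random_subset_graph_def kwise_random_subset_graph_axioms_def)
    define \<nu> where "\<nu> = real (card E) * q ^ 2"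
    show "\<bar>?P Q - ?P Q'\<bar> \<le> \<eta>"
    proof (cases "t ^ 3 \<le> \<nu>")
      case True
      have "1 - 5 / t \<le> ?P R" if R: "kwise_random_subset R A q (2 * r + 5)" for R
      proof -
        interpret R: kwise_random_subset_graph R A q "2 * r + 5" E D by (rule rg[OF R])
        have "E \<noteq> {}"
        proof
          assume "E = {}"
          hence "t ^ 3 \<le> 0" using True by (simp add: \<nu>_def)
          moreover have "0 < t ^ 3" using t by (intro zero_less_power) simp
          ultimately show False by linarith
        qed
        hence "measure_pmf.prob R {S. \<forall>e\<in>E. \<not> e \<subseteq> S} \<le> (1 + 2 * real D * q) / \<nu>"
          unfolding \<nu>_def by (rule R.prob_no_edge_le)
        also have "\<dots> \<le> 5 * t ^ 2 / t ^ 3"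
        proof (rule frac_le)
          show "1 + 2 * real D * q \<le> 5 * t ^ 2" using D_le \<open>1 \<le> t ^ 2\<close> by linarith
        qed (use t True in auto)
        also have "\<dots> = 5 / t" using t by (simp add: power2_eq_square power3_eq_cube)
        finally have "measure_pmf.prob R {S. \<forall>e\<in>E. \<not> e \<subseteq> S} \<le> 5 / t" .
        moreover have "measure_pmf.prob R (- {S. \<exists>e\<in>G. e \<subseteq> S}) \<le> measure_pmf.prob R {S. \<forall>e\<in>E. \<not> e \<subseteq> S}"
          using E(1) by (intro measure_pmf.finite_measure_mono) auto
        moreover have "measure_pmf.prob R (- {S. \<exists>e\<in>G. e \<subseteq> S}) = 1 - ?P R"
          using measure_pmf.prob_compl[of "{S. \<exists>e\<in>G. e \<subseteq> S}" R] by (simp add: Compl_eq_Diff_UNIV)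
        ultimately show ?thesis by linarith
      qed
      from this[OF Q] this[OF Q'] have "\<bar>?P Q - ?P Q'\<bar> \<le> 5 / t"
        using measure_pmf.prob_le_1[of Q "{S. \<exists>e\<in>G. e \<subseteq> S}"]
          measure_pmf.prob_le_1[of Q' "{S. \<exists>e\<in>G. e \<subseteq> S}"] by linarith
      also have "\<dots> \<le> 12 / t" using t by (intro divide_right_mono) auto
      finally show ?thesis using t by simp
    next
      case False
      \<comment> \<open>Degree counting gives \<open>card saturated * D \<le> 2 * card E\<close>;
        multiply by q^2 and divide by \<open>D * q\<close>, which is at least t^2.\<close>
      have sat: "real (card saturated) * q \<le> 2 * t"
      proof -
        have "real (card saturated * D) \<le> real (2 * card E)"
          using card_saturated_le by (rule of_nat_mono)
        hence "real (card saturated) * real D * q ^ 2 \<le> 2 * real (card E) * q ^ 2"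
          by (intro mult_right_mono) auto
        hence "real (card saturated) * q * (real D * q) \<le> 2 * t ^ 3"
          using False by (simp add: \<nu>_def power2_eq_square mult_ac)
        moreover have "real (card saturated) * q * t ^ 2 \<le> real (card saturated) * q * (real D * q)"
          using D_ge q by (intro mult_left_mono) auto
        ultimately have "(real (card saturated) * q) * t ^ 2 \<le> (2 * t) * t ^ 2"
          by (simp add: power2_eq_square power3_eq_cube)
        thus ?thesis using t by simp
      qed
      have "real (card saturated) / real D = real (card saturated) * q / (real D * q)"
        using q by simp
      also have "\<dots> \<le> 2 * t / t ^ 2"
        using sat D_ge t q by (intro frac_le) auto
      also have "\<dots> = 2 / t" by (simp add: power2_eq_square)
      finally have ratio: "real (card saturated) / real D \<le> 2 / t" .
      have "1 + real (card saturated) * q + real D * q + real (card E) * q ^ 2 \<le> C"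
        using sat D_le False by (simp add: C_def \<nu>_def)
      hence "moment witnesses q r {} \<le> C ^ r * walk_weight r 0"
        using q by (intro moment_witnesses_le) auto
      hence "t ^ (2 * r) / fact (2 * r + 1) * moment witnesses q r {}
          \<le> t ^ (2 * r) / fact (2 * r + 1) * (C ^ r * walk_weight r 0)"
        using t by (intro mult_left_mono) auto
      hence rem: "t ^ (2 * r) / fact (2 * r + 1) * moment witnesses q r {} \<le> \<eta> / 4"
        using r by linarith
      \<comment> \<open>Free of the distribution, so it serves both Q and Q'.\<close>
      define \<sigma> where
        "\<sigma> = (\<Sum>j<r. (-1) ^ j * t ^ (2 * j) / fact (2 * j + 1) * moment witnesses q j {})"
      have "\<bar>?P R - (1 - \<sigma>)\<bar> \<le> 3 / t + \<eta> / 4" if R: "kwise_random_subset R A q (2 * r + 5)" for R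
      proof -
        interpret R: kwise_random_subset_graph R A q "2 * r + 5" E D by (rule rg[OF R])
        have "\<bar>measure_pmf.prob R {S. num_contained witnesses S = 0} - \<sigma>\<bar> \<le> 1 / t + \<eta> / 4"
        proof -
          have "2 * r \<le> 2 * r + 5" "0 < t" using t by auto
          from R.prob_num_contained_0_approx[OF witnessesD this] show ?thesis
            unfolding \<sigma>_def using rem by linarith
        qed
        moreover have "\<bar>?P R - (1 - measure_pmf.prob R {S. num_contained witnesses S = 0})\<bar> \<le> 2 / t"
          using R.prob_edge_approx[of G] G E(1) max ratio by fastforce
        moreover have "3 / t = 1 / t + 2 / t" by simp
        ultimately show ?thesis by linarith
      qed
      from this[OF Q] this[OF Q'] have "\<bar>?P Q - ?P Q'\<bar> \<le> (3 / t + \<eta> / 4) + (3 / t + \<eta> / 4)" by linarith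
      also have "\<dots> = (12 / t + \<eta>) / 2" by simp
      finally show ?thesis using t by simp
    qed
  qed
qed

subsection \<open>Paired functions\<close>

lemma prob_all_bits_kwise_indep:
  assumes "Q \<in> kwise_indep n k p" "I \<subseteq> {..<n}" "card I \<le> k"
  shows "measure_pmf.prob Q {x. \<forall>i\<in>I. x i} = p ^ card I"
proof (cases "I = {}")
  case True
  thus ?thesis using measure_pmf.prob_space[of Q] by simp
next
  case False
  have indep: "prob_space.indep_vars (measure_pmf Q) (\<lambda>_. count_space UNIV) (\<lambda>i x. x i) I"
    using assms unfolding kwise_indep_def by blast
  have p: "measure_pmf.prob Q {x. x i} = p" if "i < n" for i
    using assms(1) that unfolding kwise_indep_def by blast
  have fin: "finite I" using assms(2) finite_subset by blast
  have "measure_pmf.prob Q (\<Inter>i\<in>I. (\<lambda>x. x i) -` {True} \<inter> space (measure_pmf Q))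
      = (\<Prod>i\<in>I. measure_pmf.prob Q ((\<lambda>x. x i) -` {True} \<inter> space (measure_pmf Q)))"
    by (rule prob_space.indep_varsD[where A = "\<lambda>_. {True}", OF measure_pmf.prob_space_axioms indep False fin subset_refl]) auto
  also have "(\<Inter>i\<in>I. (\<lambda>x. x i) -` {True} \<inter> space (measure_pmf Q)) = {x. \<forall>i\<in>I. x i}"
    using False by auto
  also have "(\<Prod>i\<in>I. measure_pmf.prob Q ((\<lambda>x. x i) -` {True} \<inter> space (measure_pmf Q))) = (\<Prod>i\<in>I. p)"
    using p assms(2) by (intro prod.cong) (auto simp: vimage_def)
  finally show ?thesis by simp
qed

text \<open>Ensures that the supremum and infimum in \<open>indep_gap\<close> range over a nonempty
  set.\<close>

lemma iid_bits_in_kwise_indep: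
  assumes "0 \<le> p" "p \<le> 1"
  shows "iid_bits n p \<in> kwise_indep n k p"
proof -
  have "set_pmf (iid_bits n p) \<subseteq> cube n"
    using set_Pi_pmf_subset[of "{..<n}" False "\<lambda>_. bernoulli_pmf p"]
    by (auto simp: iid_bits_def cube_def not_less)
  moreover have "prob_space.indep_vars (measure_pmf (iid_bits n p)) (\<lambda>_. count_space UNIV) (\<lambda>i x. x i) I"
    if "I \<subseteq> {..<n}" for I
    using prob_space.indep_vars_subset[OF measure_pmf.prob_space_axioms indep_vars_Pi_pmf that]
    by (simp add: iid_bits_def)
  moreover have "measure_pmf.prob (iid_bits n p) {x. x i} = p" if "i < n" for i
  proof -
    have "map_pmf (\<lambda>x. x i) (iid_bits n p) = bernoulli_pmf p"
      using that unfolding iid_bits_def by (subst Pi_pmf_component) auto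
    hence "measure_pmf.prob (map_pmf (\<lambda>x. x i) (iid_bits n p)) {True} = p"
      using assms by (simp only: measure_pmf_single pmf_bernoulli_True)
    thus ?thesis by (simp add: vimage_def)
  qed
  ultimately show ?thesis by (auto simp: kwise_indep_def)
qed

definition full_blocks :: "nat set set \<Rightarrow> (nat \<Rightarrow> bool) \<Rightarrow> nat set set" where
  "full_blocks \<A> x = {B \<in> \<A>. \<forall>i\<in>B. x i}"

text \<open>By disjointness, the blocks in V consist of \<open>card V * m\<close> bits, at most
  \<open>c * m \<le> k\<close>, so k-wise independence applies to all of them together.\<close>

lemma kwise_random_subset_full_blocks:
  assumes Q: "Q \<in> kwise_indep n k p" and p: "0 < p" "p \<le> 1"
    and \<A>: "disjoint \<A>" "\<And>B. B \<in> \<A> \<Longrightarrow> B \<subseteq> {..<n} \<and> card B = m"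
    and c: "c * m \<le> k"
  shows "kwise_random_subset (map_pmf (full_blocks \<A>) Q) \<A> (p ^ m) c"
proof
  show "finite \<A>" using \<A>(2) by (intro finite_subset[of \<A> "Pow {..<n}"]) auto
  show "set_pmf (map_pmf (full_blocks \<A>) Q) \<subseteq> Pow \<A>" by (auto simp: full_blocks_def)
  show "0 < p ^ m" "p ^ m \<le> 1" using p by (auto intro: power_le_one)
  fix V assume V: "V \<subseteq> \<A>" "card V \<le> c"
  have "card (\<Union>V) = (\<Sum>B\<in>V. card B)"
  proof (rule card_Union_disjoint)
    show "pairwise disjnt V"
      using \<A>(1) V(1) by (auto simp: disjoint_def pairwise_def disjnt_def)
    show "finite B" if "B \<in> V" for B using \<A>(2)[of B] that V(1) finite_subset by blast
  qed
  also have "\<dots> = card V * m" using \<A>(2) V(1) by (simp add: subset_iff)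
  finally have card: "card (\<Union>V) = card V * m" .
  also have "\<dots> \<le> k" using V(2) c by (meson le_trans mult_le_mono1)
  finally have "measure_pmf.prob Q {x. \<forall>i\<in>\<Union>V. x i} = p ^ card (\<Union>V)"
    using \<A>(2) V(1) by (intro prob_all_bits_kwise_indep[OF Q]) auto
  moreover have "full_blocks \<A> -` {S. V \<subseteq> S} = {x. \<forall>i\<in>\<Union>V. x i}"
    using V(1) by (auto simp: full_blocks_def)
  ultimately show "measure_pmf.prob (map_pmf (full_blocks \<A>) Q) {S. V \<subseteq> S} = (p ^ m) ^ card V"
    by (simp add: card power_mult mult.commute[of _ m])
qed

lemma abs_indep_gap_le:
  assumes "0 \<le> p" "p \<le> 1"
    and close: "\<And>Q Q'. Q \<in> kwise_indep n k p \<Longrightarrow> Q' \<in> kwise_indep n k p \<Longrightarrow>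
      \<bar>measure_pmf.prob Q {x. f x} - measure_pmf.prob Q' {x. f x}\<bar> \<le> \<eta>"
  shows "\<bar>indep_gap n f k p\<bar> \<le> \<eta>"
proof -
  let ?K = "kwise_indep n k p" and ?P = "\<lambda>Q. measure_pmf.prob Q {x. f x}"
  have I: "iid_bits n p \<in> ?K" using assms(1,2) by (rule iid_bits_in_kwise_indep)
  hence ne: "?K \<noteq> {}" by blast
  have bdd: "bdd_above (?P ` ?K)" "bdd_below (?P ` ?K)"
    by (auto intro!: bdd_aboveI[of _ 1] bdd_belowI[of _ 0])
  have "(INF Q\<in>?K. ?P Q) \<le> ?P (iid_bits n p)" "?P (iid_bits n p) \<le> (SUP Q\<in>?K. ?P Q)"
    using I bdd by (auto intro: cINF_lower cSUP_upper)
  moreover have "(SUP Q\<in>?K. ?P Q) \<le> (INF Q\<in>?K. ?P Q) + \<eta>"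
  proof (rule cSUP_least[OF ne])
    fix Q assume Q: "Q \<in> ?K"
    have "?P Q - \<eta> \<le> (INF Q\<in>?K. ?P Q)"
    proof (rule cINF_greatest[OF ne])
      fix Q' assume "Q' \<in> ?K"
      thus "?P Q - \<eta> \<le> ?P Q'" using close[OF Q] by (simp add: abs_le_iff) (smt (verit))
    qed
    thus "?P Q \<le> (INF Q\<in>?K. ?P Q) + \<eta>" by simp
  qed
  ultimately show ?thesis unfolding indep_gap_def by linarith
qed

text \<open>The uniformity of \<open>kwise_fools_graph_dnf\<close> in the graph and in q is
  essential: the gates and q = p^m vary with m while c stays fixed.\<close>

lemma indep_gap_paired:
  assumes "0 < \<eta>" "0 < p" "p \<le> 1"
  obtains c where "\<And>m f k. paired (2 ^ (2 * m)) f \<Longrightarrow> c * m \<le> k \<Longrightarrow> \<bar>indep_gap (2 ^ (2 * m)) f k p\<bar> \<le> \<eta>"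
proof -
  show thesis
  proof (rule kwise_fools_graph_dnf[OF assms(1), where 'v = "nat set"], rule that)
    fix c m k :: nat and f
    assume c: "\<And>(A :: nat set set) q Q Q' G.
      kwise_random_subset Q A q c \<Longrightarrow> kwise_random_subset Q' A q c \<Longrightarrow>
      (\<And>e. e \<in> G \<Longrightarrow> e \<subseteq> A \<and> card e = 2) \<Longrightarrow>
      \<bar>measure_pmf.prob Q {S. \<exists>e\<in>G. e \<subseteq> S} - measure_pmf.prob Q' {S. \<exists>e\<in>G. e \<subseteq> S}\<bar> \<le> \<eta>"
    assume "paired (2 ^ (2 * m)) f" and k: "c * m \<le> k"
    let ?n = "2 ^ (2 * m) :: nat"
    obtain \<A> G where \<A>: "disjoint \<A>" "\<And>B. B \<in> \<A> \<Longrightarrow> B \<subseteq> {..<?n} \<and> card B = m"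
      and G_sub: "G \<subseteq> {(B, C). B \<in> \<A> \<and> C \<in> \<A> \<and> B \<noteq> C}"
      and f: "\<And>x. x \<in> cube ?n \<Longrightarrow> f x \<longleftrightarrow> (\<exists>(B, C)\<in>G. \<forall>i\<in>B \<union> C. x i)"
      using \<open>paired (2 ^ (2 * m)) f\<close> by (auto simp: paired_def)
    have G: "B \<in> \<A> \<and> C \<in> \<A> \<and> B \<noteq> C" if "(B, C) \<in> G" for B C
      using subsetD[OF G_sub that] by simp
    \<comment> \<open>Gates become unordered edges, since both orders of a pair read the same
      bits.\<close>
    define G' where "G' = (\<lambda>(B, C). {B, C}) ` G"
    have G': "e \<subseteq> \<A> \<and> card e = 2" if e: "e \<in> G'" for e
    proof -
      obtain B C where "(B, C) \<in> G" "e = {B, C}" using e by (auto simp: G'_def)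
      thus ?thesis using G[of B C] by simp
    qed
    have f_iff: "f x \<longleftrightarrow> (\<exists>e\<in>G'. e \<subseteq> full_blocks \<A> x)" if x: "x \<in> cube ?n" for x
    proof -
      have "(\<exists>e\<in>G'. e \<subseteq> full_blocks \<A> x) \<longleftrightarrow> (\<exists>(B, C)\<in>G. {B, C} \<subseteq> full_blocks \<A> x)"
        by (simp add: G'_def case_prod_unfold)
      also have "\<dots> \<longleftrightarrow> (\<exists>(B, C)\<in>G. \<forall>i\<in>B \<union> C. x i)"
        using G by (intro bex_cong refl) (auto simp: full_blocks_def)
      finally show ?thesis using f[OF x] by blast
    qed
    have prob: "measure_pmf.prob Q {x. f x}
        = measure_pmf.prob (map_pmf (full_blocks \<A>) Q) {S. \<exists>e\<in>G'. e \<subseteq> S}"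
      if "Q \<in> kwise_indep ?n k p" for Q
    proof -
      \<comment> \<open>f is described only on the cube, which carries the whole mass of Q.\<close>
      have "{x. f x} \<inter> set_pmf Q = (full_blocks \<A> -` {S. \<exists>e\<in>G'. e \<subseteq> S}) \<inter> set_pmf Q"
        using that f_iff by (auto simp: kwise_indep_def)
      hence "measure_pmf.prob Q {x. f x}
          = measure_pmf.prob Q (full_blocks \<A> -` {S. \<exists>e\<in>G'. e \<subseteq> S})"
        using measure_Int_set_pmf[of Q "{x. f x}"]
          measure_Int_set_pmf[of Q "full_blocks \<A> -` {S. \<exists>e\<in>G'. e \<subseteq> S}"] by metis
      thus ?thesis by (simp only: measure_map_pmf)
    qed
    show "\<bar>indep_gap ?n f k p\<bar> \<le> \<eta>"
    proof (rule abs_indep_gap_le)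
      fix Q Q' assume Q: "Q \<in> kwise_indep ?n k p" "Q' \<in> kwise_indep ?n k p"
      show "\<bar>measure_pmf.prob Q {x. f x} - measure_pmf.prob Q' {x. f x}\<bar> \<le> \<eta>"
        unfolding prob[OF Q(1)] prob[OF Q(2)]
        by (rule c[OF kwise_random_subset_full_blocks[OF Q(1) assms(2,3) \<A> k]
              kwise_random_subset_full_blocks[OF Q(2) assms(2,3) \<A> k] G'])
    qed (use assms in auto)
  qed
qed

theorem theorem14:
  fixes f :: "nat \<Rightarrow> (nat \<Rightarrow> bool) \<Rightarrow> bool" and pc :: real and k :: "nat \<Rightarrow> nat"
  assumes "\<And>n. n \<in> paired_sizes \<Longrightarrow> paired n (f n)"
    and "0 < pc" and "pc < 1"
    and "sharp_threshold paired_sizes f pc"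
    and "\<And>n. n \<in> paired_sizes \<Longrightarrow> k n \<le> n"
    and "filterlim (\<lambda>n. real (k n) / ln (real n)) at_top (along paired_sizes)"
  shows "k \<in> K2 paired_sizes f pc"
  unfolding K2_def mem_Collect_eq
proof (rule tendstoI)
  fix \<epsilon> :: real assume "0 < \<epsilon>"
  then obtain c where c: "\<And>m f k. paired (2 ^ (2 * m)) f \<Longrightarrow> c * m \<le> k \<Longrightarrow>
      \<bar>indep_gap (2 ^ (2 * m)) f k pc\<bar> \<le> \<epsilon> / 2"
    using indep_gap_paired[of "\<epsilon> / 2" pc] assms(2,3) by auto
  \<comment> \<open>For n = 2^(2m), ln n = 2 m ln 2, so this bound on the ratio says that k n is at
    least c m.\<close>
  have "eventually (\<lambda>n. real c / (2 * ln 2) \<le> real (k n) / ln (real n)) (along paired_sizes)"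
    using assms(6) by (simp add: filterlim_at_top)
  moreover have "eventually (\<lambda>n. n \<in> paired_sizes) (along paired_sizes)"
    by (simp add: eventually_inf_principal)
  ultimately show "eventually (\<lambda>n. dist (indep_gap n (f n) (k n) pc) 0 < \<epsilon>) (along paired_sizes)"
  proof eventually_elim
    case (elim n)
    then obtain m where m: "m \<ge> 1" "n = 2 ^ (2 * m)" by (auto simp: paired_sizes_def)
    have ln: "ln (real n) = real m * (2 * ln 2)" by (simp add: m ln_realpow)
    hence pos: "0 < ln (real n)" using m(1) by simp
    have "real c * real m = real c / (2 * ln 2) * ln (real n)" by (simp add: ln)
    also have "\<dots> \<le> real (k n) / ln (real n) * ln (real n)"
      using elim(1) pos by (intro mult_right_mono) auto
    also have "\<dots> = real (k n)" using pos by simp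
    finally have "c * m \<le> k n" by (metis of_nat_le_iff of_nat_mult)
    hence "\<bar>indep_gap n (f n) (k n) pc\<bar> \<le> \<epsilon> / 2"
      using c[of m "f n" "k n"] assms(1)[OF elim(2)] m by simp
    thus ?case using \<open>0 < \<epsilon>\<close> by (simp add: dist_real_def)
  qed
qed

end
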